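(* In the absolute-loss game $(\Omega,\Gamma,\ell)=(\mathbb{R},\mathbb{R},\ell)$ with $\ell(\omega,\gamma)=|\omega-\gamma|$, played according to the competitive prediction protocol, Sceptic has a strategy that guarantees $$\lim_{N\to\infty}\max\left(\frac{1}{\left|\gamma^{[1]}_N-\gamma^{[2]}_N\right|},\;L^{[1]}_N-\tilde L_N,\;L^{[2]}_N-\tilde L_N\right)=\infty .$$
   Context: A game of prediction is a triple $(\Omega,\Gamma,\ell)$ where $\Omega$ (outcome space) and $\Gamma$ (prediction space) are sets and $\ell:\Omega\times\Gamma\to\mathbb{R}$ is the loss function. Competitive prediction protocol (perfect information; players: Nature, Predictor 1, Predictor 2, Sceptic): at each step $n=1,2,\ldots$, first Predictor 1 and Predictor 2 announce $\gamma_n^{[1]}\in\Gamma$ and $\gamma_n^{[2]}\in\Gamma$; then Sceptic announces $\tilde\gamma_n\in\Gamma$; then Nature announces $\omega_n\in\Omega$. A strategy for Sceptic is a function determining $\tilde\gamma_n$ from all moves made before it (the outcomes and all predictions of the steps before $n$, together with $\gamma_n^{[1]},\gamma_n^{[2]}$). It guarantees a property if the property holds for all sequences of moves of the other players when Sceptic follows it. Cumulative losses: $L_N^{[k]}=\sum_{n=1}^N\ell(\omega_n,\gamma_n^{[k]})$ for $k=1,2$, and $\tilde L_N=\sum_{n=1}^N\ell(\omega_n,\tilde\gamma_n)$. Convention: $1/0:=\infty$. *)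

theory Defs
  imports Complex_Main "HOL-Library.Extended_Real"
begin

text \<open>
  A game of prediction is given by its loss function, with the outcome space and the
  prediction space rendered as the types \<^typ>\<open>'o\<close> and \<^typ>\<open>'g\<close>.
\<close>

record ('o, 'g) round =
  pred1 :: 'g
  pred2 :: 'g
  sceptic :: 'g
  outcome :: 'o

text \<open>
  A strategy maps the completed rounds (earliest first) and the two predictions
  announced in the current step to Sceptic's prediction.
\<close>

type_synonym ('o, 'g) strategy = "('o, 'g) round list \<Rightarrow> 'g \<Rightarrow> 'g \<Rightarrow> 'g"

text \<open>Steps are numbered from 1; the values of the move sequences at 0 are never used.\<close>

primrec history ::
  "('o, 'g) strategy \<Rightarrow> (nat \<Rightarrow> 'g) \<Rightarrow> (nat \<Rightarrow> 'g) \<Rightarrow> (nat \<Rightarrow> 'o) \<Rightarrow> nat \<Rightarrow> ('o, 'g) round list"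
where
  "history S g1 g2 w 0 = []"
| "history S g1 g2 w (Suc n) =
     history S g1 g2 w n @
       [\<lparr>pred1 = g1 (Suc n), pred2 = g2 (Suc n),
         sceptic = S (history S g1 g2 w n) (g1 (Suc n)) (g2 (Suc n)),
         outcome = w (Suc n)\<rparr>]"

definition sceptic_moves ::
  "('o, 'g) strategy \<Rightarrow> (nat \<Rightarrow> 'g) \<Rightarrow> (nat \<Rightarrow> 'g) \<Rightarrow> (nat \<Rightarrow> 'o) \<Rightarrow> nat \<Rightarrow> 'g"
where
  "sceptic_moves S g1 g2 w n = S (history S g1 g2 w (n - 1)) (g1 n) (g2 n)"

text \<open>
  The property takes the moves of Predictor 1, Predictor 2, Sceptic and Nature, in this order.
  Moves of the other players that depend on the past of the play are covered, since all
  sequences of their moves are considered.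
\<close>

definition guarantees ::
  "('o, 'g) strategy \<Rightarrow>
   ((nat \<Rightarrow> 'g) \<Rightarrow> (nat \<Rightarrow> 'g) \<Rightarrow> (nat \<Rightarrow> 'g) \<Rightarrow> (nat \<Rightarrow> 'o) \<Rightarrow> bool) \<Rightarrow> bool"
where
  "guarantees S P \<longleftrightarrow> (\<forall>g1 g2 w. P g1 g2 (sceptic_moves S g1 g2 w) w)"

definition cumulative_loss ::
  "('o \<Rightarrow> 'g \<Rightarrow> real) \<Rightarrow> (nat \<Rightarrow> 'o) \<Rightarrow> (nat \<Rightarrow> 'g) \<Rightarrow> nat \<Rightarrow> real"
where
  "cumulative_loss loss w g N = (\<Sum>n=1..N. loss (w n) (g n))"

definition absolute_loss :: "real \<Rightarrow> real \<Rightarrow> real" where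
  "absolute_loss \<omega> \<gamma> = \<bar>\<omega> - \<gamma>\<bar>"

text \<open>
  The convention that 1/0 is infinite is the one of division on \<^typ>\<open>ereal\<close>
  (but not of division on \<^typ>\<open>real\<close>).
\<close>

lemma ereal_one_divide_zero: "1 / ereal 0 = \<infinity>"
  by (simp add: divide_ereal_def)

end

theory Submission imports Defs begin

text \<open>
  Sceptic mixes the two predictions with weights depending on the current difference \<open>D\<close> of
  Predictor 1's and Predictor 2's losses, always favouring the predictor that has been doing
  worse: Predictor 2 gets weight \<open>(1 - D / (1 + \<bar>D\<bar>)) / 2\<close>. This weight is the
  derivative of the strictly concave function \<open>\<Phi>(D) = (D - \<bar>D\<bar> + ln (1 + \<bar>D\<bar>)) / 2\<close>.
  Hence the regrets against the two predictors are \<open>\<Phi>(D) + A\<close> and \<open>\<Phi>(D) - D + A\<close>, where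
  \<open>A\<close> accumulates nonnegative gains of two kinds, the Jensen gap of the loss and the
  Bregman gap of \<open>\<Phi>\<close>, and the larger regret is \<open>ln (1 + \<bar>D\<bar>) / 2 + A\<close>. If it is bounded at
  infinitely many steps at which the predictions are far apart, then \<open>D\<close> is bounded after these
  steps, so each of them has a gain bounded away from zero, contradicting the boundedness
  of \<open>A\<close>.
\<close>

section \<open>The potential, the weights and lower bounds for the two gaps\<close>

definition soft_sign :: "real \<Rightarrow> real" where
  "soft_sign x = x / (1 + \<bar>x\<bar>)"

text \<open>The convex antiderivative of \<open>soft_sign\<close> that vanishes at 0; the concave
  \<Phi> of the overview is \<open>(x - potential x) / 2\<close>.\<close>

definition potential :: "real \<Rightarrow> real" where
  "potential x = \<bar>x\<bar> - ln (1 + \<bar>x\<bar>)"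

definition weight :: "real \<Rightarrow> real" where
  "weight x = (1 - soft_sign x) / 2"

definition bregman :: "real \<Rightarrow> real \<Rightarrow> real" where
  "bregman x y = potential y - potential x - soft_sign x * (y - x)"

text \<open>Convexity of \<open>potential\<close>, without derivatives: use
  \<open>ln s \<le> s - 1\<close> at \<open>s = (1 + \<bar>y\<bar>) / (1 + \<bar>x\<bar>)\<close>,
  then \<open>x * y \<le> \<bar>x\<bar> * \<bar>y\<bar>\<close>.\<close>

lemma bregman_nonneg: "0 \<le> bregman x y"
proof -
  have "ln (1 + \<bar>y\<bar>) - ln (1 + \<bar>x\<bar>) = ln ((1 + \<bar>y\<bar>) / (1 + \<bar>x\<bar>))"
    by (rule ln_divide_pos[symmetric]) (simp_all add: add_pos_nonneg)
  also have "\<dots> \<le> (1 + \<bar>y\<bar>) / (1 + \<bar>x\<bar>) - 1"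
    by (rule ln_le_minus_one) (simp add: divide_pos_pos add_pos_nonneg)
  also have "\<dots> = (\<bar>y\<bar> - \<bar>x\<bar>) / (1 + \<bar>x\<bar>)"
    by (simp add: divide_simps add_nonneg_eq_0_iff)
  finally have ln: "ln (1 + \<bar>y\<bar>) - ln (1 + \<bar>x\<bar>) \<le> (\<bar>y\<bar> - \<bar>x\<bar>) / (1 + \<bar>x\<bar>)" .
  have "x * y \<le> \<bar>x\<bar> * \<bar>y\<bar>"
    using abs_ge_self[of "x * y"] by (simp add: abs_mult)
  then have "x * (y - x) \<le> (\<bar>y\<bar> - \<bar>x\<bar>) * \<bar>x\<bar>"
    by (simp add: algebra_simps)
  then have "x * (y - x) / (1 + \<bar>x\<bar>) \<le> (\<bar>y\<bar> - \<bar>x\<bar>) * \<bar>x\<bar> / (1 + \<bar>x\<bar>)"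
    by (simp add: divide_right_mono)
  also have "\<dots> = (\<bar>y\<bar> - \<bar>x\<bar>) - (\<bar>y\<bar> - \<bar>x\<bar>) / (1 + \<bar>x\<bar>)"
    by (simp add: field_simps)
  finally show ?thesis
    using ln by (simp add: bregman_def potential_def soft_sign_def)
qed

text \<open>Over the common denominator, the numerator on the right exceeds \<open>v - u\<close> by
  \<open>v * \<bar>u\<bar> - u * \<bar>v\<bar>\<close>, which is 0 for equal signs and nonnegative
  for \<open>u < 0 < v\<close>.\<close>

lemma soft_sign_diff_ge:
  assumes "u \<le> v"
  shows "(v - u) / ((1 + \<bar>u\<bar>) * (1 + \<bar>v\<bar>)) \<le> soft_sign v - soft_sign u"
proof -
  have eq: "soft_sign v - soft_sign u
      = (v * (1 + \<bar>u\<bar>) - u * (1 + \<bar>v\<bar>)) / ((1 + \<bar>u\<bar>) * (1 + \<bar>v\<bar>))"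
    by (simp add: soft_sign_def diff_frac_eq add_nonneg_eq_0_iff mult.commute)
  have "u * \<bar>v\<bar> \<le> v * \<bar>u\<bar>"
  proof (cases "0 \<le> u \<or> v \<le> 0")
    case False
    then have "u * \<bar>v\<bar> \<le> 0" "0 \<le> v * \<bar>u\<bar>"
      by (simp_all add: mult_nonneg_nonpos mult_nonpos_nonneg)
    then show ?thesis by linarith
  qed (use assms in auto)
  then show ?thesis
    unfolding eq by (intro divide_right_mono) (auto simp: algebra_simps)
qed

lemma soft_sign_bounds: "\<bar>soft_sign x\<bar> \<le> 1 - 1 / (1 + \<bar>x\<bar>)"
  by (simp add: soft_sign_def field_simps)

lemma weight_bounds:
  assumes "\<bar>x\<bar> \<le> K"
  shows "1 / (2 * (1 + K)) \<le> weight x" "1 / (2 * (1 + K)) \<le> 1 - weight x"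
proof -
  have "1 / (1 + K) \<le> 1 / (1 + \<bar>x\<bar>)"
    using assms by (intro divide_left_mono) auto
  then have "\<bar>soft_sign x\<bar> \<le> 1 - 1 / (1 + K)"
    using soft_sign_bounds[of x] by linarith
  moreover define k where "k = 1 / (1 + K)"
  ultimately have "\<bar>soft_sign x\<bar> \<le> 1 - k" by simp
  then have "k / 2 \<le> weight x" "k / 2 \<le> 1 - weight x"
    by (simp_all add: weight_def abs_le_iff field_simps)
  then show "1 / (2 * (1 + K)) \<le> weight x" "1 / (2 * (1 + K)) \<le> 1 - weight x"
    by (simp_all add: k_def mult.commute)
qed

lemma weight_nonneg: "0 \<le> weight x" "0 \<le> 1 - weight x"
proof -
  have "0 \<le> 1 / (2 * (1 + \<bar>x\<bar>))" by simp
  then show "0 \<le> weight x" "0 \<le> 1 - weight x"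
    using weight_bounds[of x "\<bar>x\<bar>", OF order.refl] by linarith+
qed

text \<open>Stop at the point \<open>m\<close> at distance \<open>e / 2\<close> from
  \<open>y\<close> towards \<open>x\<close>. In the three-point identity two terms are Bregman gaps,
  and the third is the growth of the slope between \<open>x\<close> and \<open>m\<close> times
  \<open>e / 2\<close>. Only \<open>y\<close>, the difference after a step, is assumed
  bounded.\<close>

lemma bregman_ge:
  assumes "0 < e" "e \<le> \<bar>y - x\<bar>" "\<bar>y\<bar> \<le> K"
  shows "(e / 2)\<^sup>2 / (1 + K + e)\<^sup>2 \<le> bregman x y"
proof -
  define m where "m = (if x < y then y - e / 2 else y + e / 2)"
  define h where "h = e / 2"
  have three: "bregman x y = bregman m y + bregman x m + (soft_sign m - soft_sign x) * (y - m)"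
    by (simp add: bregman_def algebra_simps)
  have h: "0 < h" "h \<le> \<bar>m - x\<bar>" "\<bar>m\<bar> \<le> K + h"
    using assms by (auto simp: m_def h_def abs_if split: if_splits)
  have K: "0 \<le> K" using assms by linarith
  define t where "t = \<bar>m - x\<bar>"
  \<comment> \<open>A remote \<open>x\<close> forces a large \<open>t\<close>, so
    \<open>t / (1 + \<bar>x\<bar>)\<close> has a lower bound independent of
    \<open>x\<close>.\<close>
  have ht: "h * (1 + \<bar>x\<bar>) \<le> t * (1 + K + e)"
  proof -
    have "\<bar>x\<bar> \<le> K + h + t" using h by (simp add: t_def)
    then have "h * (1 + \<bar>x\<bar>) \<le> h * (1 + (K + h + t))" using h by simp
    also have "\<dots> = h * (1 + K + h) + t * h" by (simp add: algebra_simps)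
    also have "\<dots> \<le> t * (1 + K + h) + t * h"
      using h K by (simp add: t_def mult_right_mono)
    also have "\<dots> = t * (1 + K + e)" by (simp add: h_def algebra_simps)
    finally show ?thesis .
  qed
  have ss: "t / ((1 + \<bar>m\<bar>) * (1 + \<bar>x\<bar>)) * h \<le> (soft_sign m - soft_sign x) * (y - m)"
  proof (cases "x < y")
    case True
    then have "x \<le> m" "y - m = h" "t = m - x"
      using assms by (auto simp: m_def t_def h_def)
    then show ?thesis
      using mult_right_mono[OF soft_sign_diff_ge[of x m], of h] h by (simp add: mult.commute)
  next
    case False
    then have "m \<le> x" "y - m = - h" "t = x - m"
      using assms by (auto simp: m_def t_def h_def)
    then show ?thesis
      using mult_right_mono[OF soft_sign_diff_ge[of m x], of h] h
      by (simp add: mult.commute minus_diff_eq[of "soft_sign m", symmetric] del: minus_diff_eq)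
  qed
  have "h / (1 + K + e) \<le> t / (1 + \<bar>x\<bar>)"
    using ht K assms by (subst frac_le_eq) (auto simp: divide_le_0_iff add_nonneg_eq_0_iff mult.commute add_nonneg_pos)
  moreover have "h / (1 + K + e) \<le> h / (1 + \<bar>m\<bar>)"
    using h K assms by (intro divide_left_mono) (auto simp: h_def)
  ultimately have "h / (1 + K + e) * (h / (1 + K + e)) \<le> t / (1 + \<bar>x\<bar>) * (h / (1 + \<bar>m\<bar>))"
    using h K assms by (intro mult_mono) (auto simp: t_def)
  also have "\<dots> = t / ((1 + \<bar>m\<bar>) * (1 + \<bar>x\<bar>)) * h" by simp
  finally have "h\<^sup>2 / (1 + K + e)\<^sup>2 \<le> (soft_sign m - soft_sign x) * (y - m)"
    using ss by (simp add: power2_eq_square)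
  then show ?thesis
    using bregman_nonneg[of m y] bregman_nonneg[of x m] unfolding three h_def by linarith
qed

text \<open>Put \<open>u = w - a\<close> and \<open>v = w - b\<close>. For equal signs the left side
  is 0. For opposite signs the left side is \<open>2 * q * min \<bar>u\<bar> \<bar>v\<bar>\<close>
  and the right side is twice the minimum of \<open>(1 - p) * \<bar>u\<bar>\<close> and
  \<open>p * \<bar>v\<bar>\<close>.\<close>

lemma jensen_abs_gap:
  fixes a b w p q :: real
  assumes "0 \<le> q" "q \<le> p" "q \<le> 1 - p"
  shows "q * (\<bar>a - b\<bar> - \<bar>\<bar>w - a\<bar> - \<bar>w - b\<bar>\<bar>)
    \<le> (1 - p) * \<bar>w - a\<bar> + p * \<bar>w - b\<bar> - \<bar>w - ((1 - p) * a + p * b)\<bar>"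
proof -
  define u v where "u = w - a" and "v = w - b"
  have "w - ((1 - p) * a + p * b) = (1 - p) * u + p * v"
    by (simp add: u_def v_def algebra_simps)
  moreover have "\<bar>a - b\<bar> = \<bar>u - v\<bar>" by (simp add: u_def v_def)
  moreover have "q * (\<bar>u - v\<bar> - \<bar>\<bar>u\<bar> - \<bar>v\<bar>\<bar>)
      \<le> (1 - p) * \<bar>u\<bar> + p * \<bar>v\<bar> - \<bar>(1 - p) * u + p * v\<bar>"
  proof -
    have "q * (\<bar>u - v\<bar> - \<bar>\<bar>u\<bar> - \<bar>v\<bar>\<bar>) \<le> q * (2 * \<bar>u\<bar>)"
         "q * (\<bar>u - v\<bar> - \<bar>\<bar>u\<bar> - \<bar>v\<bar>\<bar>) \<le> q * (2 * \<bar>v\<bar>)"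
      by (rule mult_left_mono; use assms(1) in linarith)+
    note * = this
    have **: "q * \<bar>u\<bar> \<le> (1 - p) * \<bar>u\<bar>" "q * \<bar>v\<bar> \<le> p * \<bar>v\<bar>"
      using assms by (auto intro: mult_right_mono)
    define X where "X = q * (\<bar>u - v\<bar> - \<bar>\<bar>u\<bar> - \<bar>v\<bar>\<bar>)"
    define U V where "U = (1 - p) * u" and "V = p * v"
    have abs: "(1 - p) * \<bar>u\<bar> = \<bar>U\<bar>" "p * \<bar>v\<bar> = \<bar>V\<bar>"
      using assms by (simp_all add: U_def V_def abs_mult)
    then have X: "X \<le> 2 * \<bar>U\<bar>" "X \<le> 2 * \<bar>V\<bar>"
      using * ** by (simp_all add: X_def)
    consider "0 \<le> u \<longleftrightarrow> 0 \<le> v" | "0 \<le> u" "v \<le> 0" | "u \<le> 0" "0 \<le> v"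
      by linarith
    then have "X \<le> \<bar>U\<bar> + \<bar>V\<bar> - \<bar>U + V\<bar>"
    proof cases
      case 1
      then have "\<bar>u - v\<bar> - \<bar>\<bar>u\<bar> - \<bar>v\<bar>\<bar> = 0" by linarith
      then show ?thesis using abs_triangle_ineq[of U V] by (simp add: X_def)
    next
      case 2
      then have "0 \<le> U" "V \<le> 0"
        using assms by (simp_all add: U_def V_def mult_nonneg_nonpos)
      then show ?thesis using X by (simp add: abs_if split: if_splits)
    next
      case 3
      then have "U \<le> 0" "0 \<le> V"
        using assms by (simp_all add: U_def V_def mult_nonneg_nonpos)
      then show ?thesis using X by (simp add: abs_if split: if_splits)
    qed
    then show ?thesis by (simp only: abs X_def U_def[symmetric] V_def[symmetric])
  qed
  ultimately show ?thesis
    unfolding u_def[symmetric] v_def[symmetric] by (simp only:)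
qed

section \<open>The gain of a single step\<close>

definition mixture :: "real \<Rightarrow> real \<Rightarrow> real \<Rightarrow> real" where
  "mixture x a b = (1 - weight x) * a + weight x * b"

text \<open>In the gain, \<open>x\<close> is the loss difference before the step.\<close>

definition gain :: "real \<Rightarrow> real \<Rightarrow> real \<Rightarrow> real \<Rightarrow> real" where
  "gain x a b w = (1 - weight x) * \<bar>w - a\<bar> + weight x * \<bar>w - b\<bar> - \<bar>w - mixture x a b\<bar>
     + bregman x (x + (\<bar>w - a\<bar> - \<bar>w - b\<bar>)) / 2"

lemma gain_nonneg: "0 \<le> gain x a b w"
  using jensen_abs_gap[of 0 "weight x" a b w] weight_nonneg[of x] bregman_nonneg
  unfolding gain_def mixture_def by (intro add_nonneg_nonneg) auto

text \<open>If the two losses differ by at least \<open>e / 2\<close>, the Bregman gap gives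
  \<open>d2\<close>. Otherwise \<open>x\<close> is bounded as well, both weights are at least
  \<open>q\<close>, and the Jensen gap gives \<open>d1\<close>.\<close>

lemma gain_bounded_below:
  assumes "0 < e" "0 \<le> K"
  obtains d where "0 < d"
    "\<And>x a b w. e \<le> \<bar>a - b\<bar> \<Longrightarrow> \<bar>x + (\<bar>w - a\<bar> - \<bar>w - b\<bar>)\<bar> \<le> K \<Longrightarrow> d \<le> gain x a b w"
proof -
  define q where "q = 1 / (2 * (1 + (K + e / 2)))"
  define d1 where "d1 = q * (e / 2)"
  define d2 where "d2 = (e / 2 / 2)\<^sup>2 / (1 + K + e / 2)\<^sup>2 / 2"
  have q: "0 < q" using assms by (simp add: q_def)
  have pos: "0 < min d1 d2"
    using assms q by (simp add: d1_def d2_def)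
  have "min d1 d2 \<le> gain x a b w"
    if far: "e \<le> \<bar>a - b\<bar>" and bd: "\<bar>x + (\<bar>w - a\<bar> - \<bar>w - b\<bar>)\<bar> \<le> K" for x a b w
  proof (cases "e / 2 \<le> \<bar>\<bar>w - a\<bar> - \<bar>w - b\<bar>\<bar>")
    case True
    then have "d2 \<le> bregman x (x + (\<bar>w - a\<bar> - \<bar>w - b\<bar>)) / 2"
      unfolding d2_def using assms bd by (intro divide_right_mono bregman_ge) auto
    moreover have "0 \<le> (1 - weight x) * \<bar>w - a\<bar> + weight x * \<bar>w - b\<bar> - \<bar>w - mixture x a b\<bar>"
      using jensen_abs_gap[of 0 "weight x" a b w] weight_nonneg[of x] by (simp add: mixture_def)
    ultimately show ?thesis unfolding gain_def by linarith
  next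
    case False
    then have "\<bar>x\<bar> \<le> K + e / 2" using bd by linarith
    note w = weight_bounds[OF this, folded q_def]
    have "d1 \<le> q * (\<bar>a - b\<bar> - \<bar>\<bar>w - a\<bar> - \<bar>w - b\<bar>\<bar>)"
      unfolding d1_def using False far q by (intro mult_left_mono) auto
    also have "\<dots> \<le> (1 - weight x) * \<bar>w - a\<bar> + weight x * \<bar>w - b\<bar> - \<bar>w - mixture x a b\<bar>"
      unfolding mixture_def using q w by (intro jensen_abs_gap) auto
    finally show ?thesis
      using bregman_nonneg[of x "x + (\<bar>w - a\<bar> - \<bar>w - b\<bar>)"] unfolding gain_def by linarith
  qed
  with pos that show ?thesis by blast
qed

text \<open>Replacing the mixed loss by Predictor 1's loss adds \<open>weight x\<close> times the
  loss difference. This is the linear part of the increment of \<Phi> at \<open>x\<close>, and the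
  Bregman term in \<open>gain\<close> is the remainder; the rest telescopes over the steps.\<close>

lemma regret_step:
  "\<bar>w - a\<bar> - \<bar>w - mixture x a b\<bar>
    = gain x a b w + (x + (\<bar>w - a\<bar> - \<bar>w - b\<bar>) - potential (x + (\<bar>w - a\<bar> - \<bar>w - b\<bar>))) / 2
      - (x - potential x) / 2"
proof -
  define A B C where "A = \<bar>w - a\<bar>" and "B = \<bar>w - b\<bar>" and "C = \<bar>w - mixture x a b\<bar>"
  define P where "P = potential (x + (A - B))"
  show ?thesis
    unfolding gain_def bregman_def weight_def A_def[symmetric] B_def[symmetric] C_def[symmetric]
      P_def[symmetric]
    by (simp add: field_simps)
qed

section \<open>Sceptic's strategy and the regret over time\<close>

definition loss_gap :: "(real, real) round list \<Rightarrow> real" where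
  "loss_gap h = (\<Sum>r\<leftarrow>h. \<bar>outcome r - pred1 r\<bar> - \<bar>outcome r - pred2 r\<bar>)"

definition mixing_strategy :: "(real, real) strategy" where
  "mixing_strategy h a b = mixture (loss_gap h) a b"

lemma loss_gap_history:
  "loss_gap (history S g1 g2 w n)
    = cumulative_loss absolute_loss w g1 n - cumulative_loss absolute_loss w g2 n"
  by (induction n) (simp_all add: loss_gap_def cumulative_loss_def absolute_loss_def)

text \<open>Partial sums increase, so a bound at infinitely many indices bounds them all; then
  \<open>G\<close> is summable and tends to 0.\<close>

lemma not_frequently_ge_if_partial_sums_le:
  fixes G :: "nat \<Rightarrow> real"
  assumes "\<And>n. 0 \<le> G n" "0 < d"
    and freq: "\<exists>\<^sub>F n in sequentially. d \<le> G n \<and> (\<Sum>i<Suc n. G i) \<le> M"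
  shows False
proof -
  have "(\<Sum>i<n. G i) \<le> M" for n
  proof -
    obtain m where "n \<le> m" "(\<Sum>i<Suc m. G i) \<le> M"
      using freq unfolding frequently_sequentially by blast
    moreover have "(\<Sum>i<n. G i) \<le> (\<Sum>i<Suc m. G i)"
      using assms \<open>n \<le> m\<close> by (intro sum_mono2) auto
    ultimately show ?thesis by linarith
  qed
  then have "summable G"
    using assms by (intro summableI_nonneg_bounded) auto
  then have "\<forall>\<^sub>F n in sequentially. G n < d"
    using \<open>0 < d\<close> by (intro order_tendstoD(2)[OF summable_LIMSEQ_zero])
  then have "\<forall>\<^sub>F n in sequentially. \<not> (d \<le> G n \<and> (\<Sum>i<Suc n. G i) \<le> M)"
    by (rule eventually_mono) simp
  with freq show False
    unfolding frequently_def by (rule notE)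
qed

theorem proposition1:
  "\<exists>S :: (real, real) strategy.
     guarantees S (\<lambda>g1 g2 g w.
       (\<lambda>N. max (1 / ereal \<bar>g1 N - g2 N\<bar>)
             (max (ereal (cumulative_loss absolute_loss w g1 N - cumulative_loss absolute_loss w g N))
                  (ereal (cumulative_loss absolute_loss w g2 N - cumulative_loss absolute_loss w g N))))
       \<longlonglongrightarrow> \<infinity>)"
proof (intro exI[of _ mixing_strategy], unfold guarantees_def, intro allI)
  fix g1 g2 w :: "nat \<Rightarrow> real"
  define g where "g = sceptic_moves mixing_strategy g1 g2 w"
  define L1 L2 L where "L1 = cumulative_loss absolute_loss w g1"
    and "L2 = cumulative_loss absolute_loss w g2" and "L = cumulative_loss absolute_loss w g"
  define D where "D n = L1 n - L2 n" for n
  \<comment> \<open>\<open>G n\<close> is the gain of step \<open>n + 1\<close>, whose weights come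
    from the difference \<open>D n\<close> before that step.\<close>
  define G where "G n = gain (D n) (g1 (Suc n)) (g2 (Suc n)) (w (Suc n))" for n
  have D_Suc: "D (Suc n) = D n + (\<bar>w (Suc n) - g1 (Suc n)\<bar> - \<bar>w (Suc n) - g2 (Suc n)\<bar>)" for n
    by (simp add: D_def L1_def L2_def cumulative_loss_def absolute_loss_def)
  have g_Suc: "g (Suc n) = mixture (D n) (g1 (Suc n)) (g2 (Suc n))" for n
    by (simp add: g_def sceptic_moves_def mixing_strategy_def loss_gap_history D_def L1_def L2_def)
  have regret: "L1 n - L n = (\<Sum>i<n. G i) + (D n - potential (D n)) / 2" for n
  proof (induction n)
    case 0
    show ?case by (simp add: D_def L1_def L2_def L_def cumulative_loss_def potential_def)
  next
    case (Suc n)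
    have "L1 (Suc n) - L (Suc n)
        = L1 n - L n + (\<bar>w (Suc n) - g1 (Suc n)\<bar> - \<bar>w (Suc n) - g (Suc n)\<bar>)"
      by (simp add: L1_def L_def cumulative_loss_def absolute_loss_def)
    then show ?case
      unfolding g_Suc regret_step Suc.IH by (simp add: G_def D_Suc)
  qed
  \<comment> \<open>The maximum adds \<open>max 0 (- D n)\<close> to the first regret, which turns
    \<open>D n / 2\<close> into \<open>\<bar>D n\<bar> / 2\<close>; subtracting half the potential
    leaves the logarithm.\<close>
  have regret_max: "max (L1 n - L n) (L2 n - L n) = (\<Sum>i<n. G i) + ln (1 + \<bar>D n\<bar>) / 2" for n
    using regret[of n] by (auto simp: D_def potential_def max_def abs_if field_simps)
  have "(\<lambda>N. max (1 / ereal \<bar>g1 N - g2 N\<bar>) (max (ereal (L1 N - L N)) (ereal (L2 N - L N)))) \<longlonglongrightarrow> \<infinity>"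
    (is "?f \<longlonglongrightarrow> _")
    unfolding tendsto_PInfty
  proof (intro allI, rule ccontr)
    fix r :: real
    \<comment> \<open>Raising \<open>r\<close> to at least 1 makes \<open>1 / M\<close> a positive
      separation of the predictions.\<close>
    define M where "M = max r 1"
    assume "\<not> (\<forall>\<^sub>F N in sequentially. ereal r < ?f N)"
    then have "\<not> (\<forall>\<^sub>F n in sequentially. ereal r < ?f (Suc n))"
      by (rule contrapos_nn) (rule eventually_sequentially_Suc[THEN iffD1])
    then have freq: "\<exists>\<^sub>F n in sequentially. \<not> ereal r < ?f (Suc n)"
      by (simp add: frequently_def)
    have M: "0 < M" by (simp add: M_def)
    \<comment> \<open>\<open>1 / M\<close> comes from the bound \<open>M\<close> on the inverse
      distance, and \<open>exp (2 * M)\<close> from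
      \<open>ln (1 + \<bar>D (Suc n)\<bar>) / 2 \<le> M\<close>.\<close>
    obtain d where d: "0 < d"
      "\<And>x a b w. 1 / M \<le> \<bar>a - b\<bar> \<Longrightarrow> \<bar>x + (\<bar>w - a\<bar> - \<bar>w - b\<bar>)\<bar> \<le> exp (2 * M) \<Longrightarrow> d \<le> gain x a b w"
      using gain_bounded_below[of "1 / M" "exp (2 * M)", OF _ exp_ge_zero] M
      by (metis zero_less_divide_1_iff)
    have G_nonneg: "0 \<le> G n" for n by (simp add: G_def gain_nonneg)
    have step: "d \<le> G n \<and> (\<Sum>i<Suc n. G i) \<le> M" if "\<not> ereal r < ?f (Suc n)" for n
    proof -
      have "?f (Suc n) \<le> ereal r"
        using that by (simp only: not_less)
      also have "\<dots> \<le> ereal M"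
        by (simp add: M_def)
      finally have "?f (Suc n) \<le> ereal M" .
      then have inv: "1 / ereal \<bar>g1 (Suc n) - g2 (Suc n)\<bar> \<le> ereal M"
        and reg: "max (L1 (Suc n) - L (Suc n)) (L2 (Suc n) - L (Suc n)) \<le> M"
        by (simp_all only: max.bounded_iff ereal_less_eq)
      have far: "1 / M \<le> \<bar>g1 (Suc n) - g2 (Suc n)\<bar>"
      \<comment> \<open>Equal predictions need the extended-real quotient, which is infinite and
        contradicts \<open>inv\<close>; real division would give 0 here.\<close>
      proof (cases "g1 (Suc n) = g2 (Suc n)")
        case True
        have "1 / ereal \<bar>g1 (Suc n) - g2 (Suc n)\<bar> = \<infinity>"
          using ereal_one_divide_zero by (simp only: True diff_self abs_zero)
        with inv have "\<infinity> \<le> ereal M" by (simp only:)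
        then show ?thesis by simp
      next
        case False
        then have "1 / \<bar>g1 (Suc n) - g2 (Suc n)\<bar> \<le> M"
          using inv by (simp add: one_ereal_def)
        then show ?thesis using M False by (simp add: field_simps)
      qed
      \<comment> \<open>Both summands of \<open>regret_max\<close> are nonnegative, so the bound on
        the larger regret bounds each of them.\<close>
      have sum: "0 \<le> (\<Sum>i<Suc n. G i)" by (intro sum_nonneg G_nonneg)
      have "ln (1 + \<bar>D (Suc n)\<bar>) \<le> 2 * M"
        using reg sum unfolding regret_max by linarith
      then have "1 + \<bar>D (Suc n)\<bar> \<le> exp (2 * M)"
        by (metis abs_ge_zero add_pos_nonneg exp_le_cancel_iff exp_ln zero_less_one)
      then have "\<bar>D (Suc n)\<bar> \<le> exp (2 * M)" by linarith
      then have "d \<le> G n"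
        unfolding G_def using far by (intro d) (auto simp: D_Suc)
      moreover have "0 \<le> ln (1 + \<bar>D (Suc n)\<bar>)" by simp
      ultimately show ?thesis
        using reg unfolding regret_max by linarith
    qed
    have "\<exists>\<^sub>F n in sequentially. d \<le> G n \<and> (\<Sum>i<Suc n. G i) \<le> M"
      using freq by (rule frequently_elim1) (rule step)
    then show False
      by (rule not_frequently_ge_if_partial_sums_le[of G, OF G_nonneg \<open>0 < d\<close>])
  qed
  then show "(\<lambda>N. max (1 / ereal \<bar>g1 N - g2 N\<bar>)
     (max (ereal (cumulative_loss absolute_loss w g1 N
                   - cumulative_loss absolute_loss w (sceptic_moves mixing_strategy g1 g2 w) N))
          (ereal (cumulative_loss absolute_loss w g2 N
                   - cumulative_loss absolute_loss w (sceptic_moves mixing_strategy g1 g2 w) N))))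
     \<longlonglongrightarrow> \<infinity>"
    unfolding L1_def L2_def L_def g_def .
qed

end
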